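(* Let $N,n\ge 1$ and $s\ge 1$ be integers, and let $\frac{\mathrm{d}\boldsymbol{u}}{\mathrm{d}t} = \mathsf{P}\boldsymbol{u}$, with $\boldsymbol{u}(t)\in\mathbb{R}^{nN}$ the vector of nodal values of the conservative variables, be an energy-stable semi-discretization with respect to the norm matrix $\mathsf{H}$. Let $$\mathsf{A}_{\mathsf{D}} = -\varepsilon\, \mathsf{H}^{-1}\tilde{\mathsf{D}}_s^{\mathrm{T}}\,\mathsf{C}\,\tilde{\mathsf{D}}_s$$ be an artificial dissipation operator as defined in the context, with $\mathsf{C}$ positive semi-definite. Then the augmented semi-discretization $$\frac{\mathrm{d}\boldsymbol{u}}{\mathrm{d}t} = \mathsf{P}\boldsymbol{u} + \mathsf{A}_{\mathsf{D}}\boldsymbol{u}$$ is energy-stable.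
   Context: Setting: semi-discretizations in one space dimension of a system of $n$ equations ($n=1$ is the scalar case) on $N$ nodes. $\mathsf{P}\boldsymbol{u}$ denotes a (possibly nonlinear) summation-by-parts semi-discretization in which homogeneous boundary conditions are implicitly enforced. Norm matrix: $\mathsf{H}^{(1\mathrm{D})}\in\mathbb{R}^{N\times N}$ is diagonal and positive definite, and $\mathsf{H}=\mathsf{H}^{(1\mathrm{D})}\otimes \mathsf{I}_n$, where $\mathsf{I}_n$ is the $n\times n$ identity. The discrete energy is $\|\boldsymbol{u}\|_{\mathsf{H}}^2=\boldsymbol{u}^{\mathrm{T}}\mathsf{H}\boldsymbol{u}$. Undivided derivative operator: let $\tilde{\boldsymbol{x}}=[\tilde x_1,\dots,\tilde x_N]^{\mathrm{T}}$ with $0\le\tilde x_1<\dots<\tilde x_N\le N-1$ be the nodes on the reference domain $[0,N-1]$, with powers $\tilde{\boldsymbol{x}}^i$ taken entrywise. $\tilde{\mathsf{D}}_s^{(1\mathrm{D})}\in\mathbb{R}^{N\times N}$ is a matrix satisfying $\tilde{\mathsf{D}}_s^{(1\mathrm{D})}\tilde{\boldsymbol{x}}^i=\boldsymbol{0}$ for $i=0,\dots,s-1$ and $\tilde{\mathsf{D}}_s^{(1\mathrm{D})}\tilde{\boldsymbol{x}}^s = s!\,\boldsymbol{1}$, where $\boldsymbol{1}=[1,\dots,1]^{\mathrm{T}}\in\mathbb{R}^N$; and $\tilde{\mathsf{D}}_s=\tilde{\mathsf{D}}_s^{(1\mathrm{D})}\otimes\mathsf{I}_n$. Dissipation parameters: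 $\varepsilon\ge 0$ is a real number and $\mathsf{C}\in\mathbb{R}^{nN\times nN}$ is symmetric (and may depend on the state $\boldsymbol{u}$, in which case positive semi-definiteness is required at every state). Energy stability: a semi-discretization $\frac{\mathrm{d}\boldsymbol{u}}{\mathrm{d}t}=\boldsymbol{R}(\boldsymbol{u})$ (with homogeneous boundary conditions) is energy-stable with respect to $\mathsf{H}$ if the discrete energy is non-increasing, i.e. $\frac12\frac{\mathrm{d}}{\mathrm{d}t}\|\boldsymbol{u}\|_{\mathsf{H}}^2=\boldsymbol{u}^{\mathrm{T}}\mathsf{H}\frac{\mathrm{d}\boldsymbol{u}}{\mathrm{d}t}=\boldsymbol{u}^{\mathrm{T}}\mathsf{H}\boldsymbol{R}(\boldsymbol{u})\le 0$ for every state $\boldsymbol{u}$. *)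

theory Defs
  imports Complex_Main "Jordan_Normal_Form.Gauss_Jordan_Elimination"
begin

definition kronecker :: "'a::semiring_0 mat \<Rightarrow> 'a mat \<Rightarrow> 'a mat" where
  "kronecker A B = mat (dim_row A * dim_row B) (dim_col A * dim_col B)
     (\<lambda>(i, j). A $$ (i div dim_row B, j div dim_col B) * B $$ (i mod dim_row B, j mod dim_col B))"

(* Neither notion includes symmetry. *)
definition positive_definite :: "real mat \<Rightarrow> bool" where
  "positive_definite A \<longleftrightarrow> square_mat A \<and>
     (\<forall>v \<in> carrier_vec (dim_row A). v \<noteq> 0\<^sub>v (dim_row A) \<longrightarrow> v \<bullet> (A *\<^sub>v v) > 0)"

definition positive_semidefinite :: "real mat \<Rightarrow> bool" where
  "positive_semidefinite A \<longleftrightarrow> square_mat A \<and>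
     (\<forall>v \<in> carrier_vec (dim_row A). v \<bullet> (A *\<^sub>v v) \<ge> 0)"

definition norm_matrix_1d :: "nat \<Rightarrow> real mat \<Rightarrow> bool" where
  "norm_matrix_1d N H1 \<longleftrightarrow> H1 \<in> carrier_mat N N \<and> diagonal_mat H1 \<and> positive_definite H1"

(* Indices run over 0..<N, so x $ 0 is the first node. *)
definition reference_nodes :: "nat \<Rightarrow> real vec \<Rightarrow> bool" where
  "reference_nodes N x \<longleftrightarrow> x \<in> carrier_vec N \<and>
     (\<forall>i < N. 0 \<le> x $ i \<and> x $ i \<le> real N - 1) \<and>
     (\<forall>i j. i < j \<longrightarrow> j < N \<longrightarrow> x $ i < x $ j)"

definition vec_power :: "real vec \<Rightarrow> nat \<Rightarrow> real vec" where
  "vec_power x k = map_vec (\<lambda>a. a ^ k) x"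

definition undivided_derivative :: "nat \<Rightarrow> nat \<Rightarrow> real vec \<Rightarrow> real mat \<Rightarrow> bool" where
  "undivided_derivative N s x D1 \<longleftrightarrow> D1 \<in> carrier_mat N N \<and>
     (\<forall>i < s. D1 *\<^sub>v vec_power x i = 0\<^sub>v N) \<and>
     D1 *\<^sub>v vec_power x s = fact s \<cdot>\<^sub>v vec N (\<lambda>_. 1)"

(* mat_inverse H is Some of the two-sided inverse whenever H is invertible. *)
definition artificial_dissipation :: "real \<Rightarrow> real mat \<Rightarrow> real mat \<Rightarrow> real mat \<Rightarrow> real mat" where
  "artificial_dissipation \<epsilon> H D C =
     (- \<epsilon>) \<cdot>\<^sub>m (the (mat_inverse H) * transpose_mat D * C * D)"

definition energy :: "real mat \<Rightarrow> real vec \<Rightarrow> real" where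
  "energy H u = u \<bullet> (H *\<^sub>v u)"

(* R is the right-hand side of du/dt = R u; see half_energy_rate below for why the inequality
   says that half the time derivative of the energy is nonpositive. *)
definition energy_stable :: "real mat \<Rightarrow> (real vec \<Rightarrow> real vec) \<Rightarrow> bool" where
  "energy_stable H R \<longleftrightarrow> (\<forall>u \<in> carrier_vec (dim_row H). u \<bullet> (H *\<^sub>v R u) \<le> 0)"

lemma half_energy_rate:
  fixes u :: "real \<Rightarrow> real vec"
  assumes H: "H \<in> carrier_mat m m" and sym: "transpose_mat H = H"
    and u: "\<And>\<tau>. u \<tau> \<in> carrier_vec m" and R: "R (u t) \<in> carrier_vec m"
    and ode: "\<And>i. i < m \<Longrightarrow> ((\<lambda>\<tau>. u \<tau> $ i) has_real_derivative R (u t) $ i) (at t)"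
  shows "((\<lambda>\<tau>. 1 / 2 * energy H (u \<tau>)) has_real_derivative u t \<bullet> (H *\<^sub>v R (u t))) (at t)"
proof -
  have form: "v \<bullet> (H *\<^sub>v w) = (\<Sum>i<m. \<Sum>j<m. v $ i * H $$ (i, j) * w $ j)"
    if "v \<in> carrier_vec m" "w \<in> carrier_vec m" for v w
    using that H
    by (simp add: scalar_prod_def atLeast0LessThan sum_distrib_left mult.assoc)
  have H_swap: "H $$ (i, j) = H $$ (j, i)" if "i < m" "j < m" for i j
    using that H sym by (metis carrier_matD index_transpose_mat(1))
  let ?r = "R (u t)"
  have swap: "(\<Sum>i<m. \<Sum>j<m. ?r $ i * H $$ (i, j) * u t $ j)
      = (\<Sum>i<m. \<Sum>j<m. u t $ i * H $$ (i, j) * ?r $ j)"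
    by (subst sum.swap) (auto intro!: sum.cong simp: H_swap)
  have "((\<lambda>\<tau>. 1 / 2 * (\<Sum>i<m. \<Sum>j<m. u \<tau> $ i * H $$ (i, j) * u \<tau> $ j)) has_real_derivative
      1 / 2 * (\<Sum>i<m. \<Sum>j<m. ?r $ i * H $$ (i, j) * u t $ j + u t $ i * H $$ (i, j) * ?r $ j)) (at t)"
    by (intro DERIV_cmult DERIV_sum) (auto intro!: derivative_eq_intros ode)
  moreover have "1 / 2 * (\<Sum>i<m. \<Sum>j<m. ?r $ i * H $$ (i, j) * u t $ j + u t $ i * H $$ (i, j) * ?r $ j)
      = u t \<bullet> (H *\<^sub>v ?r)"
    using swap by (simp add: sum.distrib form[OF u R])
  ultimately show ?thesis
    by (simp add: energy_def form[OF u u])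
qed

end

theory Submission
  imports Defs "Jordan_Normal_Form.Determinant"
begin

text \<open>
  The energy rate \<open>u \<bullet> (H *\<^sub>v R u)\<close> is additive in the right-hand side \<open>R\<close>, so it suffices that
  the dissipation operator contributes a nonpositive amount of its own. The factor \<open>H\<^sup>-\<^sup>1\<close> in
  the operator cancels the \<open>H\<close> of the energy inner product, which leaves
  \<open>- \<epsilon> * (u \<bullet> (D\<^sup>T C D *\<^sub>v u)) = - \<epsilon> * (w \<bullet> (C *\<^sub>v w))\<close> with \<open>w = D *\<^sub>v u\<close>. At each fixed
  state this is the quadratic form of a positive semidefinite matrix, times a nonpositive number
  (lemma \<open>energy_rate_artificial_dissipation_nonpos\<close>). The rate involves the matrix only at the
  current state, so this pointwise argument also covers a state-dependent \<open>C\<close>.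

  The cancellation is legitimate only if \<open>H\<close> is invertible. The one-dimensional norm matrix is
  diagonal with positive entries, and the Kronecker product with the identity merely repeats each
  of these entries on a longer diagonal, so the determinant stays nonzero
  (lemma \<open>det_kronecker_norm_matrix_nonzero\<close>).
\<close>

lemma kronecker_carrier_mat:
  assumes "A \<in> carrier_mat a b" and "B \<in> carrier_mat c d"
  shows "kronecker A B \<in> carrier_mat (a * c) (b * d)"
  using assms by (auto simp: kronecker_def)

text \<open>
  Row and column index \<open>k\<close> of the product stand for the pair \<open>(k div n, k mod n)\<close> of a node and a
  component of the system. Two distinct indices differ in the node, where \<open>A\<close> vanishes, or in the
  component, where the identity vanishes.
\<close>

lemma kronecker_one_diagonal:
  fixes A :: "'a::semiring_1 mat"
  assumes A: "A \<in> carrier_mat N N" and diag: "diagonal_mat A"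
  shows "diagonal_mat (kronecker A (1\<^sub>m n))"
proof -
  have "kronecker A (1\<^sub>m n) $$ (i, j) = 0" if i: "i < N * n" and j: "j < N * n" and "i \<noteq> j" for i j
  proof -
    have n: "n > 0" using i by (cases n) auto
    have bounds: "i div n < N" "j div n < N"
      using i j by (simp_all add: less_mult_imp_div_less)
    have entry: "kronecker A (1\<^sub>m n) $$ (i, j)
        = A $$ (i div n, j div n) * (1\<^sub>m n) $$ (i mod n, j mod n)"
      using A i j by (simp add: kronecker_def)
    show ?thesis
    proof (cases "i div n = j div n")
      case True
      then have "i mod n \<noteq> j mod n"
        using \<open>i \<noteq> j\<close> by (metis div_mult_mod_eq)
      then show ?thesis using n by (simp add: entry)
    next
      case False
      then have "A $$ (i div n, j div n) = 0"
        using A diag bounds by (auto simp: diagonal_mat_def)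
      then show ?thesis by (simp add: entry)
    qed
  qed
  then show ?thesis
    using kronecker_carrier_mat[OF A one_carrier_mat[of n]] by (auto simp: diagonal_mat_def)
qed

lemma kronecker_one_diagonal_entry:
  fixes A :: "'a::semiring_1 mat"
  assumes "A \<in> carrier_mat N N" and "k < N * n"
  shows "kronecker A (1\<^sub>m n) $$ (k, k) = A $$ (k div n, k div n)"
proof -
  have "n > 0" using assms(2) by (cases n) auto
  then show ?thesis
    using assms by (simp add: kronecker_def)
qed

text \<open>A diagonal entry is the value of the quadratic form at a unit vector.\<close>

lemma positive_definite_diagonal_entry_pos:
  assumes A: "A \<in> carrier_mat N N" and pd: "positive_definite A" and i: "i < N"
  shows "A $$ (i, i) > 0"
proof -
  have "unit_vec N i \<noteq> 0\<^sub>v N"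
    using i by (metis index_unit_vec(1) index_zero_vec(1) zero_neq_one)
  then have "unit_vec N i \<bullet> (A *\<^sub>v unit_vec N i) > 0"
    using A pd by (auto simp: positive_definite_def)
  moreover have "unit_vec N i \<bullet> (A *\<^sub>v unit_vec N i) = A $$ (i, i)"
    using A i by (simp add: mult_mat_vec_def)
  ultimately show ?thesis by simp
qed

lemma det_diagonal_mat_nonzero:
  fixes A :: "'a::idom mat"
  assumes A: "A \<in> carrier_mat m m" and diag: "diagonal_mat A"
    and nonzero: "\<And>i. i < m \<Longrightarrow> A $$ (i, i) \<noteq> 0"
  shows "det A \<noteq> 0"
proof -
  have "upper_triangular A"
    using A diag by (auto simp: diagonal_mat_def upper_triangular_def)
  then have "det A = prod_list (diag_mat A)"
    using A by (rule det_upper_triangular)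
  then show ?thesis
    using A nonzero by (auto simp: diag_mat_def prod_list_zero_iff)
qed

lemma det_kronecker_norm_matrix_nonzero:
  assumes "norm_matrix_1d N H1"
  shows "det (kronecker H1 (1\<^sub>m n)) \<noteq> 0"
proof (rule det_diagonal_mat_nonzero)
  have H1: "H1 \<in> carrier_mat N N" "diagonal_mat H1" "positive_definite H1"
    using assms by (auto simp: norm_matrix_1d_def)
  show "kronecker H1 (1\<^sub>m n) \<in> carrier_mat (N * n) (N * n)"
    using H1(1) by (rule kronecker_carrier_mat) simp
  show "diagonal_mat (kronecker H1 (1\<^sub>m n))"
    using H1(1,2) by (rule kronecker_one_diagonal)
  show "kronecker H1 (1\<^sub>m n) $$ (k, k) \<noteq> 0" if k: "k < N * n" for k
  proof -
    have "H1 $$ (k div n, k div n) > 0"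
      using H1(1,3) less_mult_imp_div_less[OF k] by (rule positive_definite_diagonal_entry_pos)
    then show ?thesis
      using kronecker_one_diagonal_entry[OF H1(1) k] by simp
  qed
qed

lemma mat_inverse_of_det_nonzero:
  fixes A :: "'a::field mat"
  assumes A: "A \<in> carrier_mat m m" and "det A \<noteq> 0"
  shows "A * the (mat_inverse A) = 1\<^sub>m m" and "the (mat_inverse A) \<in> carrier_mat m m"
proof -
  have "A \<in> Units (ring_mat TYPE('a) m ())"
    using assms by (rule det_non_zero_imp_unit)
  then obtain B where "mat_inverse A = Some B"
    using mat_inverse(1)[OF A, of "()"] by (cases "mat_inverse A") auto
  then show "A * the (mat_inverse A) = 1\<^sub>m m" and "the (mat_inverse A) \<in> carrier_mat m m"
    using mat_inverse(2)[OF A] by auto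
qed

lemma congruence_quadratic_form:
  fixes C D :: "'a::comm_semiring_0 mat"
  assumes "C \<in> carrier_mat k k" and "D \<in> carrier_mat k m" and "u \<in> carrier_vec m"
  shows "u \<bullet> ((transpose_mat D * C * D) *\<^sub>v u) = (D *\<^sub>v u) \<bullet> (C *\<^sub>v (D *\<^sub>v u))"
proof -
  let ?y = "C *\<^sub>v (D *\<^sub>v u)"
  have y: "?y \<in> carrier_vec k" using assms by auto
  have "(transpose_mat D * C * D) *\<^sub>v u = transpose_mat D *\<^sub>v ?y"
  proof -
    have "(transpose_mat D * C * D) *\<^sub>v u = (transpose_mat D * C) *\<^sub>v (D *\<^sub>v u)"
      using assms by (intro assoc_mult_mat_vec[of _ m k _ m]) auto
    also have "\<dots> = transpose_mat D *\<^sub>v ?y"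
      using assms by (intro assoc_mult_mat_vec[of _ m k _ k]) auto
    finally show ?thesis .
  qed
  then have "u \<bullet> ((transpose_mat D * C * D) *\<^sub>v u) = (transpose_mat D *\<^sub>v ?y) \<bullet> u"
    using assms y by (simp add: comm_scalar_prod[of u m])
  also have "\<dots> = ?y \<bullet> (D *\<^sub>v u)"
    using assms(2,3) y by (rule transpose_vec_mult_scalar)
  also have "\<dots> = (D *\<^sub>v u) \<bullet> ?y"
    using assms y by (intro comm_scalar_prod[of _ k]) auto
  finally show ?thesis .
qed

lemma artificial_dissipation_carrier_mat:
  assumes "H \<in> carrier_mat m m" and "det H \<noteq> 0"
    and "D \<in> carrier_mat k m" and "C \<in> carrier_mat k k"
  shows "artificial_dissipation \<epsilon> H D C \<in> carrier_mat m m"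
  using assms mat_inverse_of_det_nonzero(2)[OF assms(1,2)]
  by (auto simp: artificial_dissipation_def)

lemma norm_mult_artificial_dissipation:
  assumes H: "H \<in> carrier_mat m m" and det: "det H \<noteq> 0"
    and D: "D \<in> carrier_mat k m" and C: "C \<in> carrier_mat k k"
  shows "H * artificial_dissipation \<epsilon> H D C = (- \<epsilon>) \<cdot>\<^sub>m (transpose_mat D * C * D)"
proof -
  let ?Hi = "the (mat_inverse H)"
  let ?M = "transpose_mat D * C * D"
  note Hi = mat_inverse_of_det_nonzero[OF H det]
  have Dt: "transpose_mat D \<in> carrier_mat m k" using D by simp
  have M: "?M \<in> carrier_mat m m" using Dt C D by auto
  have "?Hi * transpose_mat D * C * D = ?Hi * ?M"
    using Hi(2) Dt C D by (simp add: assoc_mult_mat[of _ m m _ k _ k] assoc_mult_mat[of _ m m _ k _ m])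
  then have "H * artificial_dissipation \<epsilon> H D C = (- \<epsilon>) \<cdot>\<^sub>m (H * (?Hi * ?M))"
    using H Hi(2) M by (simp add: artificial_dissipation_def mult_smult_distrib[of _ m m _ m])
  also have "H * (?Hi * ?M) = ?M"
    using assoc_mult_mat[OF H Hi(2) M] left_mult_one_mat[OF M] by (simp only: Hi(1))
  finally show ?thesis .
qed

text \<open>
  The dissipation operator only removes energy: with the norm matrix cancelled, the rate is the
  quadratic form of \<open>C\<close> at the undivided derivative \<open>D *\<^sub>v u\<close>, scaled by \<open>- \<epsilon>\<close>.
\<close>

lemma energy_rate_artificial_dissipation_nonpos:
  assumes H: "H \<in> carrier_mat m m" and det: "det H \<noteq> 0"
    and D: "D \<in> carrier_mat k m" and C: "C \<in> carrier_mat k k"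
    and psd: "positive_semidefinite C" and "\<epsilon> \<ge> 0" and u: "u \<in> carrier_vec m"
  shows "u \<bullet> (H *\<^sub>v (artificial_dissipation \<epsilon> H D C *\<^sub>v u)) \<le> 0"
proof -
  let ?M = "transpose_mat D * C * D"
  have M: "?M \<in> carrier_mat m m" using C D by auto
  have "H *\<^sub>v (artificial_dissipation \<epsilon> H D C *\<^sub>v u) = ((- \<epsilon>) \<cdot>\<^sub>m ?M) *\<^sub>v u"
    using assoc_mult_mat_vec[OF H artificial_dissipation_carrier_mat[OF H det D C] u]
    by (simp only: norm_mult_artificial_dissipation[OF H det D C])
  also have "\<dots> = (- \<epsilon>) \<cdot>\<^sub>v (?M *\<^sub>v u)"
    using M u by (intro eq_vecI) auto
  finally have "u \<bullet> (H *\<^sub>v (artificial_dissipation \<epsilon> H D C *\<^sub>v u)) = - \<epsilon> * (u \<bullet> (?M *\<^sub>v u))"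
    using M u by simp
  also have "u \<bullet> (?M *\<^sub>v u) = (D *\<^sub>v u) \<bullet> (C *\<^sub>v (D *\<^sub>v u))"
    using C D u by (rule congruence_quadratic_form)
  finally have rate: "u \<bullet> (H *\<^sub>v (artificial_dissipation \<epsilon> H D C *\<^sub>v u))
      = - \<epsilon> * ((D *\<^sub>v u) \<bullet> (C *\<^sub>v (D *\<^sub>v u)))" .
  have "(D *\<^sub>v u) \<bullet> (C *\<^sub>v (D *\<^sub>v u)) \<ge> 0"
    using psd C D u by (auto simp: positive_semidefinite_def)
  then show ?thesis
    using \<open>\<epsilon> \<ge> 0\<close> by (simp add: rate)
qed

theorem theorem2:
  fixes N n s :: nat and \<epsilon> :: real
    and H1 D1 H D :: "real mat" and x :: "real vec"
    and C :: "real vec \<Rightarrow> real mat" and P :: "real vec \<Rightarrow> real vec"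
  assumes "N \<ge> 1" and "n \<ge> 1" and "s \<ge> 1"
    and "norm_matrix_1d N H1" and "H = kronecker H1 (1\<^sub>m n)"
    and "reference_nodes N x"
    and "undivided_derivative N s x D1" and "D = kronecker D1 (1\<^sub>m n)"
    and "\<epsilon> \<ge> 0"
    and "\<And>u. u \<in> carrier_vec (n * N) \<Longrightarrow> C u \<in> carrier_mat (n * N) (n * N)"
    and "\<And>u. u \<in> carrier_vec (n * N) \<Longrightarrow> transpose_mat (C u) = C u"
    and "\<And>u. u \<in> carrier_vec (n * N) \<Longrightarrow> positive_semidefinite (C u)"
    and "\<And>u. u \<in> carrier_vec (n * N) \<Longrightarrow> P u \<in> carrier_vec (n * N)"
    and "energy_stable H P"
  shows "energy_stable H (\<lambda>u. P u + artificial_dissipation \<epsilon> H D (C u) *\<^sub>v u)"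
proof -
  have H1: "H1 \<in> carrier_mat N N" and D1: "D1 \<in> carrier_mat N N"
    using assms(4,7) by (auto simp: norm_matrix_1d_def undivided_derivative_def)
  have H: "H \<in> carrier_mat (n * N) (n * N)" and D: "D \<in> carrier_mat (n * N) (n * N)"
    using kronecker_carrier_mat[OF H1 one_carrier_mat[of n]]
      kronecker_carrier_mat[OF D1 one_carrier_mat[of n]]
    by (simp_all add: assms(5,8) mult.commute[of n N])
  have det: "det H \<noteq> 0"
    using assms(4) by (simp add: assms(5) det_kronecker_norm_matrix_nonzero)
  have "u \<bullet> (H *\<^sub>v (P u + artificial_dissipation \<epsilon> H D (C u) *\<^sub>v u)) \<le> 0"
    if u: "u \<in> carrier_vec (n * N)" for u
  proof -
    let ?Au = "artificial_dissipation \<epsilon> H D (C u) *\<^sub>v u"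
    note C = assms(10)[OF u] and psd = assms(12)[OF u] and Pu = assms(13)[OF u]
    have Au: "?Au \<in> carrier_vec (n * N)"
      using artificial_dissipation_carrier_mat[OF H det D C] u by (rule mult_mat_vec_carrier)
    have "u \<bullet> (H *\<^sub>v (P u + ?Au)) = u \<bullet> (H *\<^sub>v P u) + u \<bullet> (H *\<^sub>v ?Au)"
      using H u Pu Au
      by (simp add: mult_add_distrib_mat_vec scalar_prod_add_distrib[of _ "n * N"])
    moreover have "u \<bullet> (H *\<^sub>v P u) \<le> 0"
      using assms(14) H u by (simp add: energy_stable_def)
    moreover have "u \<bullet> (H *\<^sub>v ?Au) \<le> 0"
      using H det D C psd assms(9) u by (rule energy_rate_artificial_dissipation_nonpos)
    ultimately show ?thesis by simp
  qed
  then show ?thesis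
    using H by (simp add: energy_stable_def)
qed

end
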